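(* Let $k$ be a positive integer and $n\ge 0$ an integer. Let $M_n^{(k)}$ and $J_n^{(k)}$ be the $n$th higher order Mersenne and Jacobsthal numbers, respectively. Then: 1. $\left(M_n^{(k)}\right)^2=\frac{1}{2^k-1}\left(M_{2n}^{(k)}-2M_{n}^{(k)}\right)$. 2. If $n$ is even, then $M_n^{(k)}+J_n^{(k)}=2J_n^{(k)}$ if $k$ is even, and $M_n^{(k)}+J_n^{(k)}=\left(\frac{2^{k+1}}{2^k-1}\right)J_n^{(k)}$ if $k$ is odd. 3. If $n$ is odd, then $M_n^{(k)}+J_n^{(k)}=2J_n^{(k)}$ if $k$ is even, and $M_n^{(k)}+J_n^{(k)}=2\left(\frac{(2^k)^{n+1}-1}{4^k-1}\right)$ if $k$ is odd. 4. If $n$ is even, then $M_n^{(k)}J_n^{(k)}=\left(J_n^{(k)}\right)^2$ if $k$ is even, and $M_n^{(k)}J_n^{(k)}=\left(\frac{2^k+1}{2^k-1}\right)\left(J_n^{(k)}\right)^2$ if $k$ is odd. 5. If $n$ is odd, then $M_n^{(k)}J_n^{(k)}=\left(J_n^{(k)}\right)^2$ if $k$ is even, and $M_n^{(k)}J_n^{(k)}=M_n^{(2k)}$ if $k$ is odd.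
   Context: The Mersenne numbers $\{M_n\}_{n\ge 0}$ are defined by $M_0=0$, $M_1=1$, $M_{n+2}=3M_{n+1}-2M_n$, i.e. $M_n=2^n-1$. For a positive integer $k$, the higher order Mersenne numbers are $M_n^{(k)}=M_{kn}/M_k$ for $n=0,1,2,\dots$. The higher order Jacobsthal numbers are given (for positive integers $k$ and $n\ge 0$) by $$J_n^{(k)}=\frac{(2^k)^n-\left((-1)^k\right)^n}{2^k-(-1)^k}.$$ *)

theory Defs
  imports Complex_Main
begin

fun mersenne :: "nat \<Rightarrow> int" where
  "mersenne 0 = 0"
| "mersenne (Suc 0) = 1"
| "mersenne (Suc (Suc n)) = 3 * mersenne (Suc n) - 2 * mersenne n"

lemma mersenne_closed_form: "mersenne n = 2 ^ n - 1"
  by (induction n rule: mersenne.induct) auto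

text \<open>
  The order \<open>k\<close> is the first argument and the index \<open>n\<close> the second. Both sequences are defined
  as quotients of rationals, so no divisibility is presupposed; they are meant for \<open>k > 0\<close>
  (at \<open>k = 0\<close> the denominators vanish).
\<close>

definition ho_mersenne :: "nat \<Rightarrow> nat \<Rightarrow> rat" where
  "ho_mersenne k n = of_int (mersenne (k * n)) / of_int (mersenne k)"

definition ho_jacobsthal :: "nat \<Rightarrow> nat \<Rightarrow> rat" where
  "ho_jacobsthal k n = ((2 ^ k) ^ n - ((- 1) ^ k) ^ n) / (2 ^ k - (- 1) ^ k)"

end

theory Submission
  imports Defs
begin

text \<open>Put \<open>x = 2 ^ k\<close> and \<open>y = x ^ n\<close>. Then M = (y - 1)/(x - 1), and
  everything reduces to identities between rational functions of \<open>x\<close> and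
  \<open>y\<close>. For even \<open>k\<close>, J = M and the claims are trivial. For odd
  \<open>k\<close>, J = (y - (-1)^n)/(x + 1). If \<open>n\<close> is even, M and J share a
  numerator, so M/J = (x + 1)/(x - 1); if \<open>n\<close> is odd, the numerators y - 1 and y + 1
  are conjugate and multiply to y^2 - 1.\<close>

lemma ho_mersenne_closed_form: "ho_mersenne k n = ((2 ^ k) ^ n - 1) / (2 ^ k - 1)"
  by (simp add: ho_mersenne_def mersenne_closed_form power_mult)

lemma ho_jacobsthal_even_order:
  assumes "even k"
  shows "ho_jacobsthal k n = ho_mersenne k n"
  using assms by (simp add: ho_jacobsthal_def ho_mersenne_closed_form)

text \<open>Since (-1)^k = -1, only the parity of \<open>n\<close> is left to decide the
  numerator.\<close>

lemma ho_jacobsthal_odd_order: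
  assumes "odd k"
  shows "ho_jacobsthal k n = ((2 ^ k) ^ n - (- 1) ^ n) / (2 ^ k + 1)"
  using assms by (simp add: ho_jacobsthal_def)

theorem theorem2p16:
  fixes k n :: nat
  assumes "k > 0"
  shows
    "(ho_mersenne k n)\<^sup>2 = 1 / (2 ^ k - 1) * (ho_mersenne k (2 * n) - 2 * ho_mersenne k n)
     \<and> (even n \<longrightarrow>
          (even k \<longrightarrow> ho_mersenne k n + ho_jacobsthal k n = 2 * ho_jacobsthal k n)
        \<and> (odd k \<longrightarrow> ho_mersenne k n + ho_jacobsthal k n
                      = 2 ^ (k + 1) / (2 ^ k - 1) * ho_jacobsthal k n))
     \<and> (odd n \<longrightarrow>
          (even k \<longrightarrow> ho_mersenne k n + ho_jacobsthal k n = 2 * ho_jacobsthal k n)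
        \<and> (odd k \<longrightarrow> ho_mersenne k n + ho_jacobsthal k n
                      = 2 * (((2 ^ k) ^ (n + 1) - 1) / (4 ^ k - 1))))
     \<and> (even n \<longrightarrow>
          (even k \<longrightarrow> ho_mersenne k n * ho_jacobsthal k n = (ho_jacobsthal k n)\<^sup>2)
        \<and> (odd k \<longrightarrow> ho_mersenne k n * ho_jacobsthal k n
                      = (2 ^ k + 1) / (2 ^ k - 1) * (ho_jacobsthal k n)\<^sup>2))
     \<and> (odd n \<longrightarrow>
          (even k \<longrightarrow> ho_mersenne k n * ho_jacobsthal k n = (ho_jacobsthal k n)\<^sup>2)
        \<and> (odd k \<longrightarrow> ho_mersenne k n * ho_jacobsthal k n = ho_mersenne (2 * k) n))"
proof -
  define x :: rat where "x = 2 ^ k"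
  define y where "y = x ^ n"
  \<comment> \<open>Positivity of \<open>k\<close> keeps the denominators away from zero, so that
    they can be cleared.\<close>
  have "x > 1"
    using assms by (simp add: x_def one_less_power)
  then have x: "x - 1 \<noteq> 0" "x + 1 \<noteq> 0"
    by auto
  have four: "4 ^ k - 1 = (x - 1) * (x + 1)"
    using power_mult_distrib[of "2::rat" 2 k] by (simp add: x_def algebra_simps)
  have M: "ho_mersenne k n = (y - 1) / (x - 1)"
    by (simp add: ho_mersenne_closed_form x_def y_def)
  have M_double_index: "ho_mersenne k (2 * n) = (y\<^sup>2 - 1) / (x - 1)"
    by (simp add: ho_mersenne_closed_form x_def y_def power_even_eq)
  have "(2::rat) ^ (2 * k) = x\<^sup>2"
    by (simp add: x_def power_even_eq)
  \<comment> \<open>Doubling the order, like doubling the index, turns \<open>y\<close> into y^2;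
    but here the denominator becomes x^2 - 1 as well.\<close>
  then have M_double_order: "ho_mersenne (2 * k) n = (y\<^sup>2 - 1) / ((x - 1) * (x + 1))"
    by (simp add: ho_mersenne_closed_form y_def flip: power_mult)
      (simp add: algebra_simps power2_eq_square)
  have J: "ho_jacobsthal k n = (y - (- 1) ^ n) / (x + 1)" if "odd k"
    using that by (simp add: ho_jacobsthal_odd_order x_def y_def)
  \<comment> \<open>Rests on (y^2 - 1) - 2(y - 1) = (y - 1)^2.\<close>
  have square: "(ho_mersenne k n)\<^sup>2 =
      1 / (x - 1) * (ho_mersenne k (2 * n) - 2 * ho_mersenne k n)"
    using x by (simp add: M M_double_index divide_simps) (simp add: algebra_simps power2_eq_square)
  \<comment> \<open>The factor is M/J + 1, and 2x is \<open>2 ^ (k + 1)\<close>.\<close>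
  have sum_even: "ho_mersenne k n + ho_jacobsthal k n = 2 * x / (x - 1) * ho_jacobsthal k n"
    if "odd k" "even n"
    using that x by (simp add: M J divide_simps) (simp add: algebra_simps)
  \<comment> \<open>Over the common denominator, (y - 1)(x + 1) + (y + 1)(x - 1) = 2(xy - 1), where
    xy is \<open>(2 ^ k) ^ (n + 1)\<close>.\<close>
  have sum_odd: "ho_mersenne k n + ho_jacobsthal k n = 2 * ((x * y - 1) / ((x - 1) * (x + 1)))"
    if "odd k" "odd n"
    using that x by (simp add: M J divide_simps) (simp add: algebra_simps)
  have prod_even: "ho_mersenne k n * ho_jacobsthal k n =
      (x + 1) / (x - 1) * (ho_jacobsthal k n)\<^sup>2"
    if "odd k" "even n"
    using that x by (simp add: M J power2_eq_square)
  have prod_odd: "ho_mersenne k n * ho_jacobsthal k n = ho_mersenne (2 * k) n"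
    if "odd k" "odd n"
    using that by (simp add: M J M_double_order) (simp add: algebra_simps power2_eq_square)
  show ?thesis
    \<comment> \<open>Even \<open>k\<close> is settled here by J = M; \<open>four\<close> matches
      the denominator \<open>4 ^ k - 1\<close>.\<close>
    using square sum_even sum_odd prod_even prod_odd
    by (simp add: four ho_jacobsthal_even_order power2_eq_square flip: x_def y_def)
qed

end
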